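(* Let $(X,d)$ be a compact metric space without isolated points and let $f_n: X\to X$ be continuous for each $n\geq 0$. If the system $x_{n+1}=f_n(x_n)$, $n\ge0$, is topologically weakly mixing in $X$, then it is distributionally $\delta$-chaotic in a sequence for some $\delta>0$ (i.e. there exist $\delta>0$ and an increasing sequence $Q\subset\mathbf{N}$ such that the system is distributionally $\delta$-chaotic in $Q$).
   Context: $\mathbf{N}$ denotes the set of nonnegative integers. For maps $f_n:X\to X$ ($n\ge0$), $f_0^0$ is the identity map on $X$ and $f_0^n:=f_{n-1}\circ\cdots\circ f_0$ for $n\ge1$. "Increasing sequence" means a strictly increasing infinite sequence. The system is topologically weakly mixing in $X$ if for any four nonempty open subsets $U_1,V_1,U_2,V_2$ of $X$ there exists $n>0$ such that $f_0^n(U_1)\cap V_1\ne\emptyset$ and $f_0^n(U_2)\cap V_2\neq\emptyset$. For an increasing sequence $P=\{p_n\}_{n=1}^\infty\subset\mathbf{N}$, $x,y\in X$ and $\epsilon>0$, set $$F^*_{x,y}(\epsilon,P)=\limsup_{n\to\infty}\frac1n\sum_{i=1}^n\chi_{[0,\epsilon)}\big(d(f_0^{p_i}(x),f_0^{p_i}(y))\big),\qquad F_{x,y}(\epsilon,P)=\liminf_{n\to\infty}\frac1n\sum_{i=1}^n\chi_{[0,\epsilon)}\big(d(f_0^{p_i}(x),f_0^{p_i}(y))\big),$$ where $\chi_{[0,\epsilon)}$ is the characteristic function of $[0,\epsilon)$. Let $\delta>0$. A set $D\subset X$ with at least two distinct points is a distributionally $\delta$-scrambled set in the sequence $P$ if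 for all $x,y\in D$ with $x\ne y$: $F^*_{x,y}(\epsilon,P)=1$ for every $\epsilon>0$, and $F_{x,y}(\delta,P)=0$. The system is distributionally $\delta$-chaotic in the sequence $P$ if it has an uncountable distributionally $\delta$-scrambled set in $P$. *)

theory Defs
  imports "HOL-Analysis.Analysis"
begin

text \<open>The phase space is a subset \<open>X\<close> of a type of class \<^class>\<open>metric_space\<close>, with the metric
  \<^const>\<open>dist\<close>; ``open subset of \<open>X\<close>'' means relatively open.\<close>

text \<open>\<open>iter f n\<close> is $f_0^n = f_{n-1} \circ \cdots \circ f_0$.\<close>

primrec iter :: "(nat \<Rightarrow> 'a \<Rightarrow> 'a) \<Rightarrow> nat \<Rightarrow> 'a \<Rightarrow> 'a" where
  "iter f 0 = id"
| "iter f (Suc n) = f n \<circ> iter f n"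

definition weakly_mixing :: "'a::metric_space set \<Rightarrow> (nat \<Rightarrow> 'a \<Rightarrow> 'a) \<Rightarrow> bool" where
  "weakly_mixing X f \<longleftrightarrow>
    (\<forall>U1 V1 U2 V2.
      openin (top_of_set X) U1 \<and> U1 \<noteq> {} \<and> openin (top_of_set X) V1 \<and> V1 \<noteq> {} \<and>
      openin (top_of_set X) U2 \<and> U2 \<noteq> {} \<and> openin (top_of_set X) V2 \<and> V2 \<noteq> {} \<longrightarrow>
      (\<exists>n>0. iter f n ` U1 \<inter> V1 \<noteq> {} \<and> iter f n ` U2 \<inter> V2 \<noteq> {}))"

text \<open>A sequence $p_1 < p_2 < \dots$ is indexed from 0 here: \<open>P i\<close> stands for $p_{i+1}$, so the
  sum over \<open>i < n\<close> runs over $p_1, \dots, p_n$. The term for \<open>n = 0\<close> is irrelevant for the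
  limits, which are taken in \<^typ>\<open>ereal\<close> because it is a complete lattice.\<close>

definition closeness_freq ::
    "(nat \<Rightarrow> 'a::metric_space \<Rightarrow> 'a) \<Rightarrow> 'a \<Rightarrow> 'a \<Rightarrow> real \<Rightarrow> (nat \<Rightarrow> nat) \<Rightarrow> nat \<Rightarrow> real" where
  "closeness_freq f x y \<epsilon> P n =
    1 / real n * (\<Sum>i<n. indicator {0..<\<epsilon>} (dist (iter f (P i) x) (iter f (P i) y)))"

definition upper_dist ::
    "(nat \<Rightarrow> 'a::metric_space \<Rightarrow> 'a) \<Rightarrow> 'a \<Rightarrow> 'a \<Rightarrow> real \<Rightarrow> (nat \<Rightarrow> nat) \<Rightarrow> ereal" where
  "upper_dist f x y \<epsilon> P = limsup (\<lambda>n. ereal (closeness_freq f x y \<epsilon> P n))"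

definition lower_dist ::
    "(nat \<Rightarrow> 'a::metric_space \<Rightarrow> 'a) \<Rightarrow> 'a \<Rightarrow> 'a \<Rightarrow> real \<Rightarrow> (nat \<Rightarrow> nat) \<Rightarrow> ereal" where
  "lower_dist f x y \<epsilon> P = liminf (\<lambda>n. ereal (closeness_freq f x y \<epsilon> P n))"

definition distributionally_scrambled ::
    "'a::metric_space set \<Rightarrow> (nat \<Rightarrow> 'a \<Rightarrow> 'a) \<Rightarrow> real \<Rightarrow> (nat \<Rightarrow> nat) \<Rightarrow> 'a set \<Rightarrow> bool" where
  "distributionally_scrambled X f \<delta> P D \<longleftrightarrow>
    D \<subseteq> X \<and> (\<exists>x\<in>D. \<exists>y\<in>D. x \<noteq> y) \<and>
    (\<forall>x\<in>D. \<forall>y\<in>D. x \<noteq> y \<longrightarrow>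
      (\<forall>\<epsilon>>0. upper_dist f x y \<epsilon> P = 1) \<and> lower_dist f x y \<delta> P = 0)"

definition distributionally_chaotic ::
    "'a::metric_space set \<Rightarrow> (nat \<Rightarrow> 'a \<Rightarrow> 'a) \<Rightarrow> real \<Rightarrow> (nat \<Rightarrow> nat) \<Rightarrow> bool" where
  "distributionally_chaotic X f \<delta> P \<longleftrightarrow>
    (\<exists>D. uncountable D \<and> distributionally_scrambled X f \<delta> P D)"

end

theory Submission
  imports Defs
begin

text \<open>The sequence \<open>Q\<close> has to be fixed before any point of the scrambled set is known. It is
  built so that the scrambled pairs form a residual subset of \<open>X \<times> X\<close>; a category argument then
  yields an uncountable set all of whose pairs are scrambled.

  Weak mixing lets two open sets be driven simultaneously into two prescribed open sets at
  arbitrarily late times, and by continuity this holds on whole open subsets of them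
  (\<open>late_visit\<close>). Repeating this inside the shrunken sets, one pair of open sets can be sent to
  the same two targets at as many successive times as desired. Two pairs of sets at once suffice
  for this; Furstenberg's passage to more pairs relies on the iterates of a single map and is not
  available here. The indices of \<open>Q\<close> are cut into blocks, each much longer than
  everything before it. During one block, \<open>Q\<close> serves a single pair of basic open sets and a
  single pair of targets (\<open>block_itinerary\<close>). The targets are either one small ball, which makes
  the orbits close, or two balls around fixed distinct points \<open>p\<close> and \<open>p'\<close>, which keeps them
  \<open>dist p p' / 2\<close> apart.

  If every combination is served infinitely often, the pairs that are close throughout
  infinitely many blocks of the first kind and separated throughout infinitely many blocks of
  the second kind contain a countable intersection of dense open sets (\<open>residual_block_visits\<close>).
  At the end of such a block the average along \<open>Q\<close> is almost entirely determined by that block,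
  so these pairs have upper distribution \<open>1\<close> at every \<open>\<epsilon>\<close> (\<open>upper_dist_block\<close>) and lower
  distribution \<open>0\<close> at \<open>\<delta> = dist p p' / 2\<close> (\<open>lower_dist_block\<close>). Finally, a symmetric residual
  relation on a compact perfect metric space has an uncountable clique
  (\<open>residual_relation_uncountable_clique\<close>).\<close>

section \<open>Uncountable cliques of residual relations\<close>

text \<open>A weak form of Mycielski's theorem that avoids the construction of a Cantor set. As in the easy
  half of the Kuratowski--Ulam theorem, the points whose fibre in every \<open>G i\<close> is dense form a
  residual set \<open>A\<close>. If a maximal clique inside \<open>A\<close> were countable, the
  fibres over its points would have a residual intersection, and a point of \<open>A\<close> in it and outside
  the clique would extend the clique.\<close>

lemma residual_relation_uncountable_clique:
  fixes T :: "'a topology" and G :: "'i::countable \<Rightarrow> ('a \<times> 'a) set" and B :: "nat \<Rightarrow> 'a set"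
  assumes baire: "completely_metrizable_space T \<or> locally_compact_space T \<and> regular_space T"
    and T1: "t1_space T"
    and ne: "topspace T \<noteq> {}"
    and perfect: "\<And>x. \<not> openin T {x}"
    and B_open: "\<And>j. openin T (B j)" and B_ne: "\<And>j. B j \<noteq> {}"
    and B_base: "\<And>U. openin T U \<Longrightarrow> U \<noteq> {} \<Longrightarrow> \<exists>j. B j \<subseteq> U"
    and G_open: "\<And>i. openin (prod_topology T T) (G i)"
    and G_dense: "\<And>i j l. G i \<inter> (B j \<times> B l) \<noteq> {}"
    and sym: "\<And>x y. R x y \<Longrightarrow> R y x"
    and G_R: "\<And>x y. (\<And>i. (x, y) \<in> G i) \<Longrightarrow> R x y"
  shows "\<exists>D \<subseteq> topspace T. uncountable D \<and> (\<forall>x\<in>D. \<forall>y\<in>D. x \<noteq> y \<longrightarrow> R x y)"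
proof -
  \<comment> \<open>\<open>E i j\<close> consists of the points whose fibre in \<open>G i\<close> meets \<open>B j\<close>.\<close>
  define E where "E i j = fst ` (G i \<inter> (topspace T \<times> B j))" for i j
  define A where "A = topspace T \<inter> (\<Inter>i. \<Inter>j. E i j)"
  have dense: "T closure_of S = topspace T" if "\<And>l. B l \<inter> S \<noteq> {}" for S
    unfolding dense_intersects_open
  proof (intro allI impI)
    fix U assume "openin T U \<and> U \<noteq> {}"
    then obtain l where "B l \<subseteq> U"
      using B_base by metis
    then show "S \<inter> U \<noteq> {}"
      using that[of l] by auto
  qed
  have E_open: "openin T (E i j)" for i j
  proof -
    have "openin (prod_topology T T) (G i \<inter> (topspace T \<times> B j))"
      using G_open B_open by (intro openin_Int) (auto simp: openin_prod_Times_iff)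
    then show ?thesis
      using open_map_fst[of T T] unfolding open_map_def E_def by blast
  qed
  have E_dense: "T closure_of (E i j) = topspace T" for i j
  proof (rule dense)
    fix l
    obtain x y where "(x, y) \<in> G i" "x \<in> B l" "y \<in> B j"
      using G_dense[of i l j] by auto
    moreover have "x \<in> topspace T"
      using \<open>x \<in> B l\<close> B_open openin_subset by blast
    ultimately show "B l \<inter> E i j \<noteq> {}"
      unfolding E_def by force
  qed
  have fibre_open: "openin T {y \<in> topspace T. (x, y) \<in> G i}" if "x \<in> topspace T" for x i
  proof -
    have "continuous_map T (prod_topology T T) (\<lambda>y. (x, y))"
      using that by (auto simp: continuous_map_pairwise o_def)
    from openin_continuous_map_preimage[OF this G_open] show ?thesis .
  qed
  have fibre_dense: "T closure_of {y \<in> topspace T. (x, y) \<in> G i} = topspace T" if "x \<in> A" for x i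
  proof (rule dense)
    fix l
    have "x \<in> E i l"
      using that by (auto simp: A_def)
    then obtain y where "(x, y) \<in> G i" "y \<in> B l"
      by (auto simp: E_def)
    moreover have "y \<in> topspace T"
      using \<open>y \<in> B l\<close> B_open openin_subset by blast
    ultimately show "B l \<inter> {y \<in> topspace T. (x, y) \<in> G i} \<noteq> {}"
      by blast
  qed
  have delete_open: "openin T (topspace T - {x})" for x
    using T1 by (metis t1_space_openin_delete_alt openin_topspace)
  have delete_dense: "T closure_of (topspace T - {x}) = topspace T" for x
  proof (rule dense)
    fix l
    have "B l \<noteq> {x}"
      using perfect B_open by metis
    with B_ne obtain y where "y \<in> B l" "y \<noteq> x"
      by blast
    then show "B l \<inter> (topspace T - {x}) \<noteq> {}"
      using B_open openin_subset by blast
  qed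
  define \<A> where "\<A> = {D. D \<subseteq> A \<and> (\<forall>x\<in>D. \<forall>y\<in>D. x \<noteq> y \<longrightarrow> R x y)}"
  have "\<exists>M\<in>\<A>. \<forall>D\<in>\<A>. M \<subseteq> D \<longrightarrow> D = M"
  proof (rule subset_Zorn')
    fix \<C> assume chain: "subset.chain \<A> \<C>"
    have "R x y" if "C \<in> \<C>" "x \<in> C" "C' \<in> \<C>" "y \<in> C'" "x \<noteq> y" for C C' x y
    proof -
      have "C \<subseteq> C' \<or> C' \<subseteq> C" "C \<in> \<A>" "C' \<in> \<A>"
        using chain that by (auto simp: subset_chain_def)
      with that show ?thesis
        unfolding \<A>_def by blast
    qed
    moreover have "\<Union>\<C> \<subseteq> A"
      using chain by (auto simp: subset_chain_def \<A>_def)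
    ultimately show "\<Union>\<C> \<in> \<A>"
      unfolding \<A>_def by blast
  qed
  then obtain M where M: "M \<in> \<A>" and max: "\<And>D. D \<in> \<A> \<Longrightarrow> M \<subseteq> D \<Longrightarrow> D = M"
    by blast
  have "uncountable M"
  proof
    assume "countable M"
    define \<G> where "\<G> = range (\<lambda>(i, j). E i j) \<union>
      (\<lambda>(x, i). {y \<in> topspace T. (x, y) \<in> G i}) ` (M \<times> UNIV) \<union> (\<lambda>x. topspace T - {x}) ` M"
    have "countable \<G>"
      unfolding \<G>_def using \<open>countable M\<close> by auto
    moreover have "openin T S \<and> T closure_of S = topspace T" if S: "S \<in> \<G>" for S
    proof -
      consider i j where "S = E i j"
        | x i where "x \<in> M" "S = {y \<in> topspace T. (x, y) \<in> G i}"
        | x where "S = topspace T - {x}"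
        using S unfolding \<G>_def by (elim UnE) auto
      then show ?thesis
      proof cases
        case 1
        then show ?thesis
          using E_open E_dense by simp
      next
        case 2
        have "x \<in> A" "x \<in> topspace T"
          using M \<open>x \<in> M\<close> by (auto simp: \<A>_def A_def)
        with 2 show ?thesis
          using fibre_open fibre_dense by simp
      next
        case 3
        then show ?thesis
          using delete_open delete_dense by simp
      qed
    qed
    ultimately have "T closure_of \<Inter>\<G> = topspace T"
      using baire by (intro Baire_category) auto
    then obtain y where y: "y \<in> topspace T" "y \<in> \<Inter>\<G>"
      using ne openin_topspace[of T] unfolding dense_intersects_open by blast
    have "y \<in> A"
      using y by (auto simp: A_def \<G>_def)
    moreover have "R x y" if "x \<in> M" for x
    proof (rule G_R)
      fix i
      have "{y \<in> topspace T. (x, y) \<in> G i} \<in> \<G>"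
        unfolding \<G>_def using that by blast
      then show "(x, y) \<in> G i"
        using y(2) by blast
    qed
    ultimately have "insert y M \<in> \<A>"
      using M sym unfolding \<A>_def by blast
    then have "y \<in> M"
      using max by blast
    moreover have "y \<notin> M"
      using y(2) unfolding \<G>_def by blast
    ultimately show False
      by blast
  qed
  moreover have "M \<subseteq> A" and "\<forall>x\<in>M. \<forall>y\<in>M. x \<noteq> y \<longrightarrow> R x y"
    using M unfolding \<A>_def mem_Collect_eq by (rule conjunct1, rule conjunct2)
  moreover have "A \<subseteq> topspace T"
    unfolding A_def by (rule Int_lower1)
  ultimately show ?thesis
    by (meson order_trans)
qed

lemma compact_countable_open_pi_base:
  fixes X :: "'a::metric_space set"
  assumes "compact X" "X \<noteq> {}"
  shows "\<exists>B::nat \<Rightarrow> 'a set. (\<forall>j. openin (top_of_set X) (B j) \<and> B j \<noteq> {}) \<and>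
    (\<forall>U. openin (top_of_set X) U \<longrightarrow> U \<noteq> {} \<longrightarrow> (\<exists>j. B j \<subseteq> U))"
proof -
  have "\<exists>C. finite C \<and> C \<subseteq> X \<and> X \<subseteq> (\<Union>c\<in>C. ball c (1 / real (Suc n)))" for n
    using seq_compact_imp_totally_bounded[of X] compact_imp_seq_compact[OF \<open>compact X\<close>] by simp
  then obtain C where C: "\<And>n. finite (C n)" "\<And>n. C n \<subseteq> X"
      "\<And>n. X \<subseteq> (\<Union>c\<in>C n. ball c (1 / real (Suc n)))"
    by metis
  define \<B> where "\<B> = (\<Union>n. (\<lambda>c. X \<inter> ball c (1 / real (Suc n))) ` C n)"
  have "countable \<B>"
    unfolding \<B>_def using C(1) by (auto intro: countable_finite)
  moreover have "\<B> \<noteq> {}"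
  proof -
    have "C 0 \<noteq> {}"
      using C(3)[of 0] \<open>X \<noteq> {}\<close> by auto
    then show ?thesis
      unfolding \<B>_def by auto
  qed
  ultimately have ran: "range (from_nat_into \<B>) = \<B>"
    by (simp add: range_from_nat_into)
  have "openin (top_of_set X) S \<and> S \<noteq> {}" if S: "S \<in> \<B>" for S
  proof -
    obtain n c where "c \<in> C n" "S = X \<inter> ball c (1 / real (Suc n))"
      using S unfolding \<B>_def by (elim UN_E imageE)
    moreover have "c \<in> S"
      using calculation C(2) by auto
    ultimately show ?thesis
      by blast
  qed
  moreover have "\<exists>S\<in>\<B>. S \<subseteq> U" if U: "openin (top_of_set X) U" "U \<noteq> {}" for U
  proof -
    obtain x e where x: "x \<in> U" "e > 0" "ball x e \<inter> X \<subseteq> U"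
      using U by (metis all_not_in_conv openin_contains_ball)
    obtain n where n: "1 / real (Suc n) < e / 2"
      using x(2) by (metis half_gt_zero nat_approx_posE)
    have "x \<in> X"
      using U(1) x(1) openin_imp_subset by blast
    then obtain c where c: "c \<in> C n" "dist c x < 1 / real (Suc n)"
      using C(3)[of n] by auto
    have "X \<inter> ball c (1 / real (Suc n)) \<subseteq> ball x e \<inter> X"
    proof
      fix z assume z: "z \<in> X \<inter> ball c (1 / real (Suc n))"
      have "dist x z \<le> dist c x + dist c z"
        by (metis dist_commute dist_triangle)
      also have "\<dots> < e"
        using z c n by auto
      finally show "z \<in> ball x e \<inter> X"
        using z by auto
    qed
    then show ?thesis
      using c x(3) by (intro bexI[of _ "X \<inter> ball c (1 / real (Suc n))"]) (auto simp: \<B>_def)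
  qed
  ultimately show ?thesis
    using ran by (metis rangeE rangeI)
qed

section \<open>Prescribed itineraries in weakly mixing systems\<close>

locale perfect_weakly_mixing =
  fixes X :: "'a::metric_space set" and f :: "nat \<Rightarrow> 'a \<Rightarrow> 'a"
  assumes perfect: "\<And>x. x \<in> X \<Longrightarrow> x islimpt X"
    and maps: "\<And>n. f n \<in> X \<rightarrow> X"
    and cont: "\<And>n. continuous_on X (f n)"
    and mixing: "weakly_mixing X f"
begin

abbreviation nonempty_open :: "'a set \<Rightarrow> bool" where
  "nonempty_open U \<equiv> openin (top_of_set X) U \<and> U \<noteq> {}"

lemma iter_maps: "iter f n \<in> X \<rightarrow> X"
  by (induction n) (use maps in auto)

lemma continuous_on_iter: "continuous_on X (iter f n)"
proof (induction n)
  case (Suc n)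
  have "iter f n ` X \<subseteq> X"
    using iter_maps by blast
  then show ?case
    using Suc cont continuous_on_compose continuous_on_subset by (metis iter.simps(2))
qed simp

lemma openin_iter_vimage:
  assumes "open S"
  shows "openin (top_of_set X) {x \<in> X. iter f n x \<in> S}"
  using continuous_openin_preimage_gen[OF continuous_on_iter assms]
  by (simp add: vimage_def Int_def)

lemma infinite_nonempty_open: "nonempty_open U \<Longrightarrow> infinite U"
  using perfect unfolding openin_open islimpt_eq_acc_point
  by (metis Int_commute Int_iff all_not_in_conv)

text \<open>The definition of weak mixing only provides some positive time. To exclude the times up to
  \<open>N\<close>, a point \<open>u\<close> of \<open>U\<close> is chosen and \<open>V\<close> is cut down to a ball around a point
  that the orbit of \<open>u\<close> avoids up to time \<open>N\<close>; such a point exists since \<open>V\<close> is infinite.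
  All points close to \<open>u\<close> then miss this ball up to time \<open>N\<close>.\<close>

lemma late_visit:
  assumes "nonempty_open U" "nonempty_open U'" "nonempty_open V" "nonempty_open V'"
  obtains n W W' where "n > N"
    "nonempty_open W" "W \<subseteq> U" "iter f n ` W \<subseteq> V"
    "nonempty_open W'" "W' \<subseteq> U'" "iter f n ` W' \<subseteq> V'"
proof -
  obtain u where u: "u \<in> U" "u \<in> X"
    using assms(1) openin_imp_subset by blast
  define F where "F = (\<lambda>k. iter f k u) ` {..N}"
  have "finite F"
    by (simp add: F_def)
  then obtain v where v: "v \<in> V" "v \<in> - F"
    using infinite_nonempty_open[OF assms(3)] by (metis ComplI finite_subset subsetI)
  have "open (- F)"
    using \<open>finite F\<close> by (simp add: finite_imp_closed open_Compl)
  then obtain e where e: "e > 0" "ball v e \<subseteq> - F"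
    using v(2) open_contains_ball by blast
  define U0 where "U0 = U \<inter> (\<Inter>k\<in>{..N}. {x \<in> X. iter f k x \<in> - cball v (e/2)})"
  define V0 where "V0 = V \<inter> ball v (e/2)"
  have "openin (top_of_set X) U0"
    unfolding U0_def using assms(1)
    by (intro openin_Int openin_INT2 openin_iter_vimage) (auto simp: open_Compl)
  moreover have "u \<in> U0"
  proof -
    have "dist v (iter f k u) \<ge> e" if "k \<le> N" for k
      using e(2) that unfolding F_def by force
    then show ?thesis
      using u e(1) by (force simp: U0_def)
  qed
  moreover have "nonempty_open V0"
    using assms(3) v(1) e(1) unfolding V0_def by (auto intro: openin_Int_open)
  ultimately obtain n where n: "iter f n ` U0 \<inter> V0 \<noteq> {}" "iter f n ` U' \<inter> V' \<noteq> {}"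
    using mixing assms unfolding weakly_mixing_def by (metis empty_iff)
  have "n > N"
  proof (rule ccontr)
    assume "\<not> n > N"
    moreover obtain x where x: "x \<in> U0" "iter f n x \<in> V0"
      using n(1) by blast
    ultimately have "iter f n x \<in> - cball v (e/2)"
      by (simp add: U0_def)
    with x(2) show False
      by (simp add: V0_def)
  qed
  have preimage: "nonempty_open (Y \<inter> {x \<in> X. iter f n x \<in> Z})"
    if Y: "nonempty_open Y" and Z: "nonempty_open Z" and meet: "iter f n ` Y \<inter> Z \<noteq> {}" for Y Z
  proof -
    obtain S where S: "open S" "Z = X \<inter> S"
      using Z unfolding openin_open by blast
    have "{x \<in> X. iter f n x \<in> Z} = {x \<in> X. iter f n x \<in> S}"
      using S(2) iter_maps by blast
    then have "openin (top_of_set X) {x \<in> X. iter f n x \<in> Z}"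
      using openin_iter_vimage[OF S(1)] by simp
    moreover have "Y \<subseteq> X"
      using Y openin_imp_subset by blast
    then have "Y \<inter> {x \<in> X. iter f n x \<in> Z} \<noteq> {}"
      using meet by blast
    ultimately show ?thesis
      using Y by (simp add: openin_Int)
  qed
  have "iter f n ` U \<inter> V \<noteq> {}"
    using n(1) unfolding U0_def V0_def by blast
  then have "nonempty_open (U \<inter> {x \<in> X. iter f n x \<in> V})" "nonempty_open (U' \<inter> {x \<in> X. iter f n x \<in> V'})"
    using preimage assms n(2) by auto
  from that[OF \<open>n > N\<close> this(1) _ _ this(2)] show ?thesis
    by auto
qed

text \<open>The function \<open>b\<close> names the task served at each index of the sequence of times.
  Within a run of equal tasks the sets \<open>W i\<close>, \<open>W' i\<close> shrink, so the sets at the end of the run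
  satisfy the requirements of all its times; when the task changes, the construction starts afresh
  from the sets \<open>U\<close>, \<open>U'\<close> of the new task.\<close>

lemma block_itinerary:
  fixes b :: "nat \<Rightarrow> nat"
  assumes open_sets: "\<And>k. nonempty_open (U k)" "\<And>k. nonempty_open (U' k)"
    "\<And>k. nonempty_open (V k)" "\<And>k. nonempty_open (V' k)"
  obtains q W W' where "strict_mono q"
    "\<And>i. nonempty_open (W i)" "\<And>i. nonempty_open (W' i)"
    "\<And>i. W i \<subseteq> U (b i)" "\<And>i. W' i \<subseteq> U' (b i)"
    "\<And>i. iter f (q i) ` W i \<subseteq> V (b i)" "\<And>i. iter f (q i) ` W' i \<subseteq> V' (b i)"
    "\<And>i. b (Suc i) = b i \<Longrightarrow> W (Suc i) \<subseteq> W i" "\<And>i. b (Suc i) = b i \<Longrightarrow> W' (Suc i) \<subseteq> W' i"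
proof -
  define P where "P i = (\<lambda>(n, Y, Y'). nonempty_open Y \<and> nonempty_open Y' \<and>
    Y \<subseteq> U (b i) \<and> Y' \<subseteq> U' (b i) \<and> iter f n ` Y \<subseteq> V (b i) \<and> iter f n ` Y' \<subseteq> V' (b i))" for i
  define Q where "Q i = (\<lambda>(n::nat, Y::'a set, Y'::'a set) (m, Z, Z'). n < m \<and>
    (b (Suc i) = b i \<longrightarrow> Z \<subseteq> Y \<and> Z' \<subseteq> Y'))" for i :: nat
  have "\<exists>s. \<forall>i. P i (s i) \<and> Q i (s i) (s (Suc i))"
  proof (rule dependent_nat_choice)
    obtain n Y Y' where "nonempty_open Y" "Y \<subseteq> U (b 0)" "iter f n ` Y \<subseteq> V (b 0)"
        "nonempty_open Y'" "Y' \<subseteq> U' (b 0)" "iter f n ` Y' \<subseteq> V' (b 0)"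
      using open_sets by (rule late_visit)
    then have "P 0 (n, Y, Y')"
      by (simp add: P_def)
    then show "\<exists>x. P 0 x" ..
  next
    fix x i assume "P i x"
    obtain n Y Y' where x: "x = (n, Y, Y')"
      by (cases x)
    define Z where "Z = (if b (Suc i) = b i then Y else U (b (Suc i)))"
    define Z' where "Z' = (if b (Suc i) = b i then Y' else U' (b (Suc i)))"
    have Z: "nonempty_open Z" "nonempty_open Z'" "Z \<subseteq> U (b (Suc i))" "Z' \<subseteq> U' (b (Suc i))"
      using \<open>P i x\<close> open_sets by (auto simp: P_def x Z_def Z'_def)
    obtain m W W' where m: "m > n" "nonempty_open W" "W \<subseteq> Z" "iter f m ` W \<subseteq> V (b (Suc i))"
      "nonempty_open W'" "W' \<subseteq> Z'" "iter f m ` W' \<subseteq> V' (b (Suc i))"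
      using Z(1,2) open_sets(3,4) by (rule late_visit)
    then have "P (Suc i) (m, W, W') \<and> Q i x (m, W, W')"
      using Z by (auto simp: P_def Q_def x Z_def Z'_def)
    then show "\<exists>y. P (Suc i) y \<and> Q i x y" ..
  qed
  then obtain s where s: "\<And>i. P i (s i)" "\<And>i. Q i (s i) (s (Suc i))"
    by blast
  show ?thesis
  proof (rule that)
    show "strict_mono (\<lambda>i. fst (s i))"
      using s(2) by (simp add: strict_mono_Suc_iff Q_def split_beta)
  next
    fix i
    show "nonempty_open (fst (snd (s i)))" "nonempty_open (snd (snd (s i)))"
      "fst (snd (s i)) \<subseteq> U (b i)" "snd (snd (s i)) \<subseteq> U' (b i)"
      "iter f (fst (s i)) ` fst (snd (s i)) \<subseteq> V (b i)"
      "iter f (fst (s i)) ` snd (snd (s i)) \<subseteq> V' (b i)"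
      using s(1)[of i] by (simp_all only: P_def split_beta simp_thms)
    show "fst (snd (s (Suc i))) \<subseteq> fst (snd (s i))" "snd (snd (s (Suc i))) \<subseteq> snd (snd (s i))"
      if "b (Suc i) = b i"
      using s(2)[of i] that by (simp_all only: Q_def split_beta simp_thms)
  qed
qed

end

section \<open>Averages dominated by long blocks\<close>

lemma block_index:
  fixes a :: "nat \<Rightarrow> nat"
  assumes "strict_mono a"
  shows "\<exists>b. \<forall>k i. a k \<le> i \<longrightarrow> i < a (Suc k) \<longrightarrow> b i = k"
proof (intro exI allI impI)
  fix k i assume i: "a k \<le> i" "i < a (Suc k)"
  show "(LEAST k. i < a (Suc k)) = k"
  proof (rule Least_equality)
    fix l assume "i < a (Suc l)"
    with i(1) have "a k < a (Suc l)"
      by simp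
    then show "k \<le> l"
      using strict_mono_less[OF assms] by auto
  qed (rule i(2))
qed

text \<open>Block \<open>k\<close> is \<open>k + 1\<close> times as long as the set of all indices before it.\<close>

definition block :: "nat \<Rightarrow> nat set" where
  "block k = {fact (Suc k)..<fact (Suc (Suc k))}"

text \<open>Only the indices before the block contribute, and up to the end of the block they make up a
  share of \<open>1 / (k + 2)\<close>.\<close>

lemma average_before_block_le:
  fixes s :: "nat \<Rightarrow> real"
  assumes "\<And>i. s i \<le> 1" and "\<And>i. i \<in> block k \<Longrightarrow> s i = 0"
  shows "1 / real (fact (Suc (Suc k))) * (\<Sum>i<fact (Suc (Suc k)). s i) \<le> 1 / real (k + 2)"
proof -
  define n :: nat where "n = fact (Suc k)"
  have n: "n > 0" "(fact (Suc (Suc k)) :: nat) = (k + 2) * n"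
    by (simp_all add: n_def)
  have "(\<Sum>i<fact (Suc (Suc k)). s i) = (\<Sum>i<n. s i)"
    using assms(2) n by (intro sum.mono_neutral_right) (auto simp: block_def n_def not_less simp del: fact_Suc)
  also have "\<dots> \<le> (\<Sum>i<n. 1)"
    using assms(1) by (intro sum_mono)
  finally have "(\<Sum>i<fact (Suc (Suc k)). s i) \<le> real n"
    by simp
  then have "1 / real ((k + 2) * n) * (\<Sum>i<fact (Suc (Suc k)). s i) \<le> 1 / real ((k + 2) * n) * real n"
    by (intro mult_left_mono) auto
  also have "\<dots> = 1 / real (k + 2)"
    unfolding of_nat_mult using n(1) by (simp del: of_nat_add)
  finally show ?thesis
    by (simp only: n(2))
qed

lemma liminf_average_block:
  fixes s :: "nat \<Rightarrow> real"
  assumes s: "\<And>i. 0 \<le> s i" "\<And>i. s i \<le> 1"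
    and often: "\<And>m. \<exists>k\<ge>m. \<forall>i\<in>block k. s i = 0"
  shows "liminf (\<lambda>n. ereal (1 / real n * (\<Sum>i<n. s i))) = 0"
proof (rule antisym)
  show "liminf (\<lambda>n. ereal (1 / real n * (\<Sum>i<n. s i))) \<ge> 0"
    using s(1) by (intro Liminf_bounded always_eventually) (simp add: sum_nonneg)
  show "liminf (\<lambda>n. ereal (1 / real n * (\<Sum>i<n. s i))) \<le> 0"
  proof (rule ccontr)
    assume "\<not> ?thesis"
    then have "0 < liminf (\<lambda>n. ereal (1 / real n * (\<Sum>i<n. s i)))"
      by (simp only: not_le)
    from ereal_dense2[OF this] obtain c
      where c: "0 < c" "ereal c < liminf (\<lambda>n. ereal (1 / real n * (\<Sum>i<n. s i)))"
      by auto
    from less_LiminfD[OF c(2)] obtain N where N: "\<And>n. n \<ge> N \<Longrightarrow> c < 1 / real n * (\<Sum>i<n. s i)"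
      unfolding eventually_sequentially less_ereal.simps(1) by blast
    obtain m where m: "1 / real (Suc m) < c"
      using c(1) nat_approx_posE by blast
    obtain k where k: "k \<ge> max N m" "\<forall>i\<in>block k. s i = 0"
      using often by blast
    have "fact (Suc (Suc k)) \<ge> N"
      using k(1) fact_ge_self[of "Suc (Suc k)"] by linarith
    from N[OF this] have "c < 1 / real (k + 2)"
      using average_before_block_le[of s k] s(2) k(2) by fastforce
    also have "\<dots> \<le> 1 / real (Suc m)"
      using k(1) by (simp add: field_simps)
    finally show False
      using m by simp
  qed
qed

text \<open>The complementary averages of \<open>1 - s\<close> reduce this to the lower limit.\<close>

lemma limsup_average_block:
  fixes s :: "nat \<Rightarrow> real"
  assumes s: "\<And>i. 0 \<le> s i" "\<And>i. s i \<le> 1"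
    and often: "\<And>m. \<exists>k\<ge>m. \<forall>i\<in>block k. s i = 1"
  shows "limsup (\<lambda>n. ereal (1 / real n * (\<Sum>i<n. s i))) = 1"
proof -
  \<comment> \<open>This fails for \<open>n = 0\<close>, where both averages are \<open>0\<close>.\<close>
  have average: "1 - 1 / real n * (\<Sum>i<n. s i) = 1 / real n * (\<Sum>i<n. 1 - s i)" if "n > 0" for n
    using that by (simp add: sum_subtractf field_simps)
  have "0 = liminf (\<lambda>n. ereal (1 / real n * (\<Sum>i<n. 1 - s i)))"
    using s often by (intro liminf_average_block[symmetric]) auto
  also have "\<dots> = liminf (\<lambda>n. 1 - ereal (1 / real n * (\<Sum>i<n. s i)))"
  proof (intro Liminf_eq eventually_sequentiallyI[of 1])
    fix n :: nat assume "1 \<le> n"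
    then show "ereal (1 / real n * (\<Sum>i<n. 1 - s i)) = 1 - ereal (1 / real n * (\<Sum>i<n. s i))"
      using average[of n] by (simp add: one_ereal_def)
  qed
  also have "\<dots> = 1 - limsup (\<lambda>n. ereal (1 / real n * (\<Sum>i<n. s i)))"
    by (intro liminf_ereal_cminus) auto
  finally show ?thesis
    by (cases "limsup (\<lambda>n. ereal (1 / real n * (\<Sum>i<n. s i)))") (auto simp: one_ereal_def zero_ereal_def)
qed

lemma upper_dist_block:
  assumes "\<epsilon> > 0"
    and often: "\<And>m. \<exists>k\<ge>m. \<forall>i\<in>block k. dist (iter f (P i) x) (iter f (P i) y) < 1 / real (Suc k)"
  shows "upper_dist f x y \<epsilon> P = 1"
  unfolding upper_dist_def closeness_freq_def
proof (rule limsup_average_block)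
  fix m
  obtain l where l: "1 / real (Suc l) < \<epsilon>"
    using \<open>\<epsilon> > 0\<close> nat_approx_posE by blast
  obtain k where k: "k \<ge> max m l"
      "\<forall>i\<in>block k. dist (iter f (P i) x) (iter f (P i) y) < 1 / real (Suc k)"
    using often by blast
  have "1 / real (Suc k) \<le> 1 / real (Suc l)"
    using k(1) by (simp add: field_simps)
  with l k show "\<exists>k\<ge>m. \<forall>i\<in>block k.
      indicator {0..<\<epsilon>} (dist (iter f (P i) x) (iter f (P i) y)) = (1::real)"
    by (intro exI[of _ k]) (fastforce simp: indicator_def)
qed (auto simp: indicator_def)

lemma lower_dist_block:
  assumes "\<And>m. \<exists>k\<ge>m. \<forall>i\<in>block k. dist (iter f (P i) x) (iter f (P i) y) \<ge> \<delta>"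
  shows "lower_dist f x y \<delta> P = 0"
  unfolding lower_dist_def closeness_freq_def
proof (rule liminf_average_block)
  fix m
  show "\<exists>k\<ge>m. \<forall>i\<in>block k.
      indicator {0..<\<delta>} (dist (iter f (P i) x) (iter f (P i) y)) = (0::real)"
    using assms[of m] by (fastforce simp: indicator_def)
qed (auto simp: indicator_def)

lemma recurrent_enumeration:
  "\<exists>\<sigma> :: nat \<Rightarrow> 'b::countable. \<forall>x m. \<exists>k\<ge>m. \<sigma> k = x"
proof (rule exI[of _ "\<lambda>k. from_nat (fst (prod_decode k))"], intro allI)
  fix x :: 'b and m
  show "\<exists>k\<ge>m. from_nat (fst (prod_decode k)) = x"
    by (intro exI[of _ "prod_encode (to_nat x, m)"]) (simp add: le_prod_encode_2)
qed

section \<open>Distributional chaos\<close>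

context perfect_weakly_mixing
begin

text \<open>A task consists of a label \<open>t\<close>, which selects the targets, and a pair of indices of basic sets.
  Each block carries out one task, and each task recurs infinitely often. The basic sets make
  \<open>G (t, m)\<close> dense, while the recurrence allows the visits to be postponed beyond any given \<open>m\<close>.\<close>

lemma residual_block_visits:
  fixes B :: "nat \<Rightarrow> 'a set" and V V' :: "'t::countable \<Rightarrow> nat \<Rightarrow> 'a set"
  assumes "\<And>j. nonempty_open (B j)"
    and "\<And>t k. nonempty_open (V t k)" "\<And>t k. nonempty_open (V' t k)"
  shows "\<exists>q G. strict_mono q \<and>
    (\<forall>t m. openin (prod_topology (top_of_set X) (top_of_set X)) (G (t, m))) \<and>
    (\<forall>t m j l. G (t, m) \<inter> (B j \<times> B l) \<noteq> {}) \<and>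
    (\<forall>t m x y. (x, y) \<in> G (t, m) \<longrightarrow>
       (\<exists>k\<ge>m. \<forall>i\<in>block k. iter f (q i) x \<in> V t k \<and> iter f (q i) y \<in> V' t k))"
proof -
  define a :: "nat \<Rightarrow> nat" where "a k = fact (Suc k)" for k
  have a: "strict_mono a"
    unfolding a_def strict_mono_Suc_iff by (auto intro: fact_less_mono simp del: fact_Suc)
  then obtain b where b: "\<And>k i. a k \<le> i \<Longrightarrow> i < a (Suc k) \<Longrightarrow> b i = k"
    using block_index by blast
  obtain \<sigma> :: "nat \<Rightarrow> 't \<times> nat \<times> nat" where \<sigma>: "\<And>x m. \<exists>k\<ge>m. \<sigma> k = x"
    using recurrent_enumeration by metis
  obtain q W W' where q: "strict_mono q"
    and W: "\<And>i. nonempty_open (W i)" "\<And>i. nonempty_open (W' i)"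
    and start: "\<And>i. W i \<subseteq> B (fst (snd (\<sigma> (b i))))" "\<And>i. W' i \<subseteq> B (snd (snd (\<sigma> (b i))))"
    and visit: "\<And>i. iter f (q i) ` W i \<subseteq> V (fst (\<sigma> (b i))) (b i)"
      "\<And>i. iter f (q i) ` W' i \<subseteq> V' (fst (\<sigma> (b i))) (b i)"
    and shrink: "\<And>i. b (Suc i) = b i \<Longrightarrow> W (Suc i) \<subseteq> W i"
      "\<And>i. b (Suc i) = b i \<Longrightarrow> W' (Suc i) \<subseteq> W' i"
    by (rule block_itinerary[of "\<lambda>k. B (fst (snd (\<sigma> k)))" "\<lambda>k. B (snd (snd (\<sigma> k)))"
      "\<lambda>k. V (fst (\<sigma> k)) k" "\<lambda>k. V' (fst (\<sigma> k)) k" b, OF assms(1,1,2,3)]) (rule that)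
  \<comment> \<open>At the last index \<open>e k\<close> of block \<open>k\<close>, the sets have passed all requirements of the block.\<close>
  define e where "e k = a (Suc k) - 1" for k
  have e: "a k \<le> e k" "e k < a (Suc k)" for k
    using strict_monoD[OF a, of k "Suc k"] by (auto simp: e_def)
  have nested: "W (e k) \<subseteq> W i \<and> W' (e k) \<subseteq> W' i" if "i \<in> block k" for k i
  proof -
    have i: "a k \<le> i" "i \<le> e k"
      using that by (auto simp: block_def a_def e_def simp del: fact_Suc)
    have "W n \<subseteq> W i \<and> W' n \<subseteq> W' i" if "i \<le> n" "n < a (Suc k)" for n
      using that
    proof (induction n rule: dec_induct)
      case (step n)
      then have "b (Suc n) = b n"
        using b[of k n] b[of k "Suc n"] i(1) by simp
      with step shrink[of n] show ?case
        by auto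
    qed simp
    then show ?thesis
      using i(2) e(2) by blast
  qed
  define G where "G = (\<lambda>(t, m). \<Union>k \<in> {k. k \<ge> m \<and> fst (\<sigma> k) = t}. W (e k) \<times> W' (e k))"
  show ?thesis
  proof (intro exI[of _ q] exI[of _ G] conjI allI impI)
    fix t m
    show "openin (prod_topology (top_of_set X) (top_of_set X)) (G (t, m))"
      unfolding G_def using W by (auto intro!: openin_Union openin_Times)
  next
    fix t m j l
    obtain k where k: "k \<ge> m" "\<sigma> k = (t, j, l)"
      using \<sigma> by blast
    have "W (e k) \<subseteq> B j" "W' (e k) \<subseteq> B l"
      using start[of "e k"] b[OF e, of k] k(2) by auto
    moreover obtain x y where "x \<in> W (e k)" "y \<in> W' (e k)"
      using W by blast
    ultimately show "G (t, m) \<inter> (B j \<times> B l) \<noteq> {}"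
      using k unfolding G_def by fastforce
  next
    fix t m x y assume "(x, y) \<in> G (t, m)"
    then obtain k where k: "k \<ge> m" "fst (\<sigma> k) = t" "x \<in> W (e k)" "y \<in> W' (e k)"
      by (auto simp: G_def)
    have "iter f (q i) x \<in> V t k \<and> iter f (q i) y \<in> V' t k" if "i \<in> block k" for i
    proof -
      have "b i = k"
        using that b by (auto simp: block_def a_def simp del: fact_Suc)
      then show ?thesis
        using visit[of i] nested[OF that] k by blast
    qed
    with k(1) show "\<exists>k\<ge>m. \<forall>i\<in>block k. iter f (q i) x \<in> V t k \<and> iter f (q i) y \<in> V' t k"
      by blast
  qed (rule q)
qed

end

theorem theorem4p3:
  fixes X :: "'a::metric_space set" and f :: "nat \<Rightarrow> 'a \<Rightarrow> 'a"
  assumes "compact X" and "X \<noteq> {}"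
    and "\<And>x. x \<in> X \<Longrightarrow> \<not> x isolated_in X"
    and "\<And>n. f n \<in> X \<rightarrow> X"
    and "\<And>n. continuous_on X (f n)"
    and "weakly_mixing X f"
  shows "\<exists>\<delta>>0. \<exists>Q. strict_mono Q \<and> distributionally_chaotic X f \<delta> Q"
proof -
  interpret perfect_weakly_mixing X f
    using assms by unfold_locales (auto simp: isolated_in_islimpt_iff)
  obtain B :: "nat \<Rightarrow> 'a set" where B: "\<And>j. nonempty_open (B j)"
      "\<And>U. nonempty_open U \<Longrightarrow> \<exists>j. B j \<subseteq> U"
    using compact_countable_open_pi_base[OF assms(1,2)] by metis
  obtain p where p: "p \<in> X"
    using assms(2) by blast
  then obtain p' where p': "p' \<in> X" "p' \<noteq> p"
    using perfect[OF p] by (metis islimpt_approachable zero_less_one)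
  \<comment> \<open>Points in balls of radius \<open>\<delta> / 2\<close> around \<open>p\<close> and \<open>p'\<close> are at distance at least
    \<open>2 * \<delta> - \<delta> = \<delta>\<close>. The label \<open>True\<close> asks for proximity, \<open>False\<close> for separation.\<close>
  define \<delta> where "\<delta> = dist p p' / 2"
  have "\<delta> > 0"
    using p' by (simp add: \<delta>_def)
  define V where "V t k = X \<inter> ball p (if t then 1 / real (Suc k) / 2 else \<delta> / 2)" for t k
  define V' where "V' t k = (if t then V t k else X \<inter> ball p' (\<delta> / 2))" for t k
  have V: "nonempty_open (V t k)" "nonempty_open (V' t k)" for t k
  proof -
    have "p \<in> V t k" "(if t then p else p') \<in> V' t k"
      using p p' \<open>\<delta> > 0\<close> by (auto simp: V_def V'_def)
    moreover have "openin (top_of_set X) (V t k)" "openin (top_of_set X) (V' t k)"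
      by (auto simp: V_def V'_def)
    ultimately show "nonempty_open (V t k)" "nonempty_open (V' t k)"
      by blast+
  qed
  obtain Q G where Q: "strict_mono Q"
    and G_open: "\<And>t m. openin (prod_topology (top_of_set X) (top_of_set X)) (G (t, m))"
    and G_dense: "\<And>t m j l. G (t, m) \<inter> (B j \<times> B l) \<noteq> {}"
    and G: "\<And>t m x y. (x, y) \<in> G (t, m) \<Longrightarrow>
       \<exists>k\<ge>m. \<forall>i\<in>block k. iter f (Q i) x \<in> V t k \<and> iter f (Q i) y \<in> V' t k"
    using residual_block_visits[of B V V', OF B(1) V] by metis
  define R where "R x y \<longleftrightarrow> (\<forall>\<epsilon>>0. upper_dist f x y \<epsilon> Q = 1) \<and> lower_dist f x y \<delta> Q = 0" for x y
  have R: "R x y" if "\<And>i. (x, y) \<in> G i" for x y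
    unfolding R_def
  proof (intro conjI allI impI)
    fix \<epsilon> :: real assume "\<epsilon> > 0"
    have close: "dist z w < 1 / real (Suc k)" if "z \<in> V True k" "w \<in> V' True k" for z w k
      using that dist_triangle_half_r[of p z "1 / real (Suc k)" w] by (auto simp: V_def V'_def)
    show "upper_dist f x y \<epsilon> Q = 1"
    proof (rule upper_dist_block[OF \<open>\<epsilon> > 0\<close>])
      show "\<exists>k\<ge>m. \<forall>i\<in>block k. dist (iter f (Q i) x) (iter f (Q i) y) < 1 / real (Suc k)" for m
        using G[OF that] close by meson
    qed
  next
    have far: "dist z w \<ge> \<delta>" if "z \<in> V False k" "w \<in> V' False k" for z w k
    proof -
      have "2 * \<delta> \<le> dist p z + dist z w + dist p' w"
        unfolding \<delta>_def using dist_triangle[of p p' z] dist_triangle[of z p' w]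
        by (simp add: dist_commute)
      then show ?thesis
        using that by (simp add: V_def V'_def)
    qed
    show "lower_dist f x y \<delta> Q = 0"
    proof (rule lower_dist_block)
      show "\<exists>k\<ge>m. \<forall>i\<in>block k. \<delta> \<le> dist (iter f (Q i) x) (iter f (Q i) y)" for m
        using G[OF that] far by meson
    qed
  qed
  have "\<exists>D \<subseteq> topspace (top_of_set X). uncountable D \<and> (\<forall>x\<in>D. \<forall>y\<in>D. x \<noteq> y \<longrightarrow> R x y)"
  proof (rule residual_relation_uncountable_clique[where B = B and G = G])
    have "compact_space (top_of_set X)"
      using assms(1) by (simp add: compact_space_subtopology)
    moreover have "Hausdorff_space (top_of_set X)"
      by (simp add: Hausdorff_space_subtopology)
    ultimately show "completely_metrizable_space (top_of_set X) \<or>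
        locally_compact_space (top_of_set X) \<and> regular_space (top_of_set X)"
      by (simp add: compact_imp_locally_compact_space compact_Hausdorff_or_regular_imp_normal_space compact_Hausdorff_imp_regular_space)
    show "t1_space (top_of_set X)"
      using \<open>Hausdorff_space (top_of_set X)\<close> Hausdorff_imp_t1_space by blast
    show "\<not> openin (top_of_set X) {x}" for x
      using infinite_nonempty_open[of "{x}"] by auto
    show "R y x" if "R x y" for x y
      using that by (simp add: R_def upper_dist_def lower_dist_def closeness_freq_def dist_commute)
    show "openin (prod_topology (top_of_set X) (top_of_set X)) (G i)" for i
      using G_open by (cases i) auto
    show "G i \<inter> (B j \<times> B l) \<noteq> {}" for i j l
      using G_dense by (cases i) auto
  qed (use assms(2) B R in auto)
  then obtain D where D: "D \<subseteq> X" "uncountable D" "\<And>x y. x \<in> D \<Longrightarrow> y \<in> D \<Longrightarrow> x \<noteq> y \<Longrightarrow> R x y"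
    by auto
  have "\<exists>x\<in>D. \<exists>y\<in>D. x \<noteq> y"
    using D(2) by (metis countable_finite finite.simps insertI1 is_singletonI' is_singleton_def)
  with D have "distributionally_scrambled X f \<delta> Q D"
    unfolding distributionally_scrambled_def R_def by blast
  then show ?thesis
    using \<open>\<delta> > 0\<close> Q D(2) unfolding distributionally_chaotic_def by blast
qed

end
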